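(* In the weighted graph setting described in the context (connected weighted graph with nodes partitioned as $\mathcal V = B\cup\Omega^+\cup\partial\Omega\cup\Omega^-$, conductivity $\sigma$, edge partition of unity $p^\pm$, Laplacian $L=L(\sigma)$), the following four reproduction formulas hold, for $u\in\mathbb R^{|\mathcal V|}$: 1. if $(Lu)|_{\Omega^-\cup\partial\Omega}=0$, then $\mathcal S(\gamma_1^+u)-\mathcal D^+(\gamma_0u)=u\,\mathbb 1_{\partial\Omega\cup\Omega^-}$; 2. if $(Lu)|_{\Omega^-}=0$, then $\mathcal S(\gamma_1^-u)-\mathcal D^-(\gamma_0u)=u\,\mathbb 1_{\Omega^-}$; 3. if $(Lu)|_{\Omega^+}=0$ and $u|_B=0$, then $-\mathcal S(\gamma_1^+u)+\mathcal D^+(\gamma_0u)=u\,\mathbb 1_{B\cup\Omega^+}$; 4. if $(Lu)|_{\Omega^+\cup\partial\Omega}=0$ and $u|_B=0$, then $-\mathcal S(\gamma_1^-u)+\mathcal D^-(\gamma_0u)=u\,\mathbb 1_{B\cup\Omega^+\cup\partial\Omega}$. Here $\mathbb 1_X\in\mathbb R^{|\mathcal V|}$ is the indicator vector of $X\subset\mathcal V$ and products of vectors are componentwise.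
   Context: Graph. $\mathcal G=(\mathcal V,\mathcal E)$ is a finite connected undirected graph without self-edges. $\mathcal V$ is partitioned into four nonempty disjoint sets $B,\Omega^+,\partial\Omega,\Omega^-$ such that, among pairs of distinct sets of the partition, the only ones joined by at least one edge are $\{B,\Omega^+\}$, $\{\Omega^+,\partial\Omega\}$, $\{\partial\Omega,\Omega^-\}$ (so there are no edges between $B$ and $\partial\Omega$, $B$ and $\Omega^-$, or $\Omega^+$ and $\Omega^-$). Put $\mathcal V^\circ=\mathcal V\setminus B$. Laplacian. The discrete gradient $\nabla$ is the $|\mathcal E|\times|\mathcal V|$ matrix with $(\nabla u)_k=u_i-u_j$, where $i,j$ are the endpoints of edge $k$ in a fixed order. For $s\in[0,\infty)^{|\mathcal E|}$, $L(s)=\nabla^T\mathrm{diag}(s)\nabla$. A conductivity $\sigma\in(0,\infty)^{|\mathcal E|}$ is fixed. $L[X,Y]$ denotes the submatrix with rows $X$, columns $Y$; $R_X$ is the $|X|\times|\mathcal V|$ matrix with $R_Xu=u|_X$. Green function. $G=R_{\mathcal V^\circ}^T\,L(\sigma)[\mathcal V^\circ,\mathcal V^\circ]^{-1}R_{\mathcal V^\circ}$ (the inverse exists since $\mathcal G$ is connected). Edge partition of unity. Let $\mathcal E^+$ be the edges with at least one node in $B\cup\Omega^+$ and $\mathcal E^-$ the edges with at least one node in $\Omega^-$. Fix any $p^+,p^-\in[0,1]^{|\mathcal E|}$ with $p^++p^-=1$, $p^+|_{\mathcal E^+}=1$, $p^-|_{\mathcal E^-}=1$. Set $\sigma^\pm=p^\pm\sigma$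 (componentwise), so $L(\sigma)=L(\sigma^+)+L(\sigma^-)$. Traces and potentials. $\gamma_0=R_{\partial\Omega}$, $\gamma_1^\pm=\mp R_{\partial\Omega}L(\sigma^\pm)$, $\mathcal S=G\gamma_0^T$, $\mathcal D^\pm=G[\gamma_1^\pm]^T$. *)

theory Defs
  imports "HOL-Analysis.Analysis" "HOL-Library.Disjoint_Sets"
begin

(* Nodes form a finite type 'v and edges a finite type 'e.  Edge k has the endpoints
   fst (ends k) and snd (ends k), in the fixed order used by the gradient; the graph
   itself is undirected, and distinct edges have distinct endpoint pairs. *)

definition simple_graph :: "('e::finite \<Rightarrow> 'v::finite \<times> 'v) \<Rightarrow> bool" where
  "simple_graph ends \<longleftrightarrow>
     (\<forall>k. fst (ends k) \<noteq> snd (ends k)) \<and>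
     inj (\<lambda>k. {fst (ends k), snd (ends k)})"

definition adjacent :: "('e::finite \<Rightarrow> 'v::finite \<times> 'v) \<Rightarrow> 'v \<Rightarrow> 'v \<Rightarrow> bool" where
  "adjacent ends i j \<longleftrightarrow> (\<exists>k. ends k = (i, j) \<or> ends k = (j, i))"

definition connected_graph :: "('e::finite \<Rightarrow> 'v::finite \<times> 'v) \<Rightarrow> bool" where
  "connected_graph ends \<longleftrightarrow> (\<forall>i j. (adjacent ends)\<^sup>*\<^sup>* i j)"

definition joined :: "('e::finite \<Rightarrow> 'v::finite \<times> 'v) \<Rightarrow> 'v set \<Rightarrow> 'v set \<Rightarrow> bool" where
  "joined ends X Y \<longleftrightarrow> (\<exists>i\<in>X. \<exists>j\<in>Y. adjacent ends i j)"

definition edges_touching :: "('e::finite \<Rightarrow> 'v::finite \<times> 'v) \<Rightarrow> 'v set \<Rightarrow> 'e set" where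
  "edges_touching ends X = {k. fst (ends k) \<in> X \<or> snd (ends k) \<in> X}"

definition gradient :: "('e::finite \<Rightarrow> 'v::finite \<times> 'v) \<Rightarrow> real^'v^'e" where
  "gradient ends =
     (\<chi> k j. (if j = fst (ends k) then 1 else 0) - (if j = snd (ends k) then 1 else 0))"

lemma gradient_mult_vec:
  "(gradient ends *v u) $ k = u $ fst (ends k) - u $ snd (ends k)"
  by (simp add: gradient_def matrix_vector_mult_def left_diff_distrib sum_subtractf
      if_distrib [of "\<lambda>x. x * _"] cong: if_cong)

definition diag_mat_of :: "real^'n \<Rightarrow> real^'n^'n::finite" where
  "diag_mat_of s = (\<chi> i j. if i = j then s $ i else 0)"

definition laplacian :: "('e::finite \<Rightarrow> 'v::finite \<times> 'v) \<Rightarrow> real^'e \<Rightarrow> real^'v^'v" where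
  "laplacian ends s = transpose (gradient ends) ** diag_mat_of s ** gradient ends"

(* Dimensions are types, so a matrix or vector indexed by a subset X of the nodes is
   indexed by a type 'x together with a bijection ix from 'x onto X, which lists the
   elements of X. *)

definition restr :: "('x::finite \<Rightarrow> 'v::finite) \<Rightarrow> real^'v^'x" where
  "restr ix = (\<chi> a j. if j = ix a then 1 else 0)"

lemma restr_mult_vec: "(restr ix *v u) $ a = u $ ix a"
  by (simp add: restr_def matrix_vector_mult_def if_distrib [of "\<lambda>x. x * _"] cong: if_cong)

definition sub_matrix ::
  "real^'v^'v \<Rightarrow> ('x::finite \<Rightarrow> 'v::finite) \<Rightarrow> ('y::finite \<Rightarrow> 'v) \<Rightarrow> real^'y^'x" where
  "sub_matrix A ix iy = (\<chi> a b. A $ ix a $ iy b)"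

(* For green, potentials and traces: iC lists the complement of B, iD the interface. *)

definition green ::
  "('e::finite \<Rightarrow> 'v::finite \<times> 'v) \<Rightarrow> real^'e \<Rightarrow> ('c::finite \<Rightarrow> 'v) \<Rightarrow> real^'v^'v" where
  "green ends \<sigma> iC =
     transpose (restr iC) ** matrix_inv (sub_matrix (laplacian ends \<sigma>) iC iC) ** restr iC"

definition gamma0 :: "('d::finite \<Rightarrow> 'v::finite) \<Rightarrow> real^'v^'d" where
  "gamma0 iD = restr iD"

definition gamma1_plus ::
  "('e::finite \<Rightarrow> 'v::finite \<times> 'v) \<Rightarrow> real^'e \<Rightarrow> real^'e \<Rightarrow> ('d::finite \<Rightarrow> 'v) \<Rightarrow> real^'v^'d" where
  "gamma1_plus ends \<sigma> pp iD = - (restr iD ** laplacian ends (pp * \<sigma>))"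

definition gamma1_minus ::
  "('e::finite \<Rightarrow> 'v::finite \<times> 'v) \<Rightarrow> real^'e \<Rightarrow> real^'e \<Rightarrow> ('d::finite \<Rightarrow> 'v) \<Rightarrow> real^'v^'d" where
  "gamma1_minus ends \<sigma> pm iD = restr iD ** laplacian ends (pm * \<sigma>)"

definition single_layer ::
  "('e::finite \<Rightarrow> 'v::finite \<times> 'v) \<Rightarrow> real^'e \<Rightarrow> ('c::finite \<Rightarrow> 'v) \<Rightarrow>
   ('d::finite \<Rightarrow> 'v) \<Rightarrow> real^'d^'v" where
  "single_layer ends \<sigma> iC iD = green ends \<sigma> iC ** transpose (gamma0 iD)"

definition double_layer_plus ::
  "('e::finite \<Rightarrow> 'v::finite \<times> 'v) \<Rightarrow> real^'e \<Rightarrow> real^'e \<Rightarrow> ('c::finite \<Rightarrow> 'v) \<Rightarrow>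
   ('d::finite \<Rightarrow> 'v) \<Rightarrow> real^'d^'v" where
  "double_layer_plus ends \<sigma> pp iC iD =
     green ends \<sigma> iC ** transpose (gamma1_plus ends \<sigma> pp iD)"

definition double_layer_minus ::
  "('e::finite \<Rightarrow> 'v::finite \<times> 'v) \<Rightarrow> real^'e \<Rightarrow> real^'e \<Rightarrow> ('c::finite \<Rightarrow> 'v) \<Rightarrow>
   ('d::finite \<Rightarrow> 'v) \<Rightarrow> real^'d^'v" where
  "double_layer_minus ends \<sigma> pm iC iD =
     green ends \<sigma> iC ** transpose (gamma1_minus ends \<sigma> pm iD)"

definition ind_vec :: "'v::finite set \<Rightarrow> real^'v" where
  "ind_vec X = (\<chi> i. indicator X i)"

end

theory Submission
  imports Defs
begin

text \<open>
  Let \<open>P\<close> be multiplication by the indicator of \<open>\<partial>\<Omega>\<close>. Since \<open>L(\<sigma>\<^sup>\<plusminus>)\<close> is symmetric, the layer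
  potentials in each formula combine to \<open>G\<close> applied to \<open>\<plusminus>(L(\<sigma>\<^sup>\<plusminus>) P u - P L(\<sigma>\<^sup>\<plusminus>) u)\<close>.
  As \<open>G\<close> inverts the Dirichlet problem, it suffices to see that the truncation \<open>v\<close> of \<open>u\<close> vanishes on
  \<open>B\<close> and that \<open>L(\<sigma>) v\<close> is this source off \<open>B\<close>. Now \<open>L(\<sigma>\<^sup>+)\<close> neither sees nor
  charges \<open>\<Omega>\<^sup>-\<close>, and \<open>L(\<sigma>\<^sup>-)\<close> neither sees nor charges \<open>B \<union> \<Omega>\<^sup>+\<close>; splitting
  \<open>L(\<sigma>) v = L(\<sigma>\<^sup>+) v + L(\<sigma>\<^sup>-) v\<close> and using the equation for \<open>u\<close> gives the source.
\<close>

text \<open>As a simp rule this turns \<open>transpose A *v x\<close> into \<open>x v* A\<close>, a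
  form that the rules below do not match.\<close>

declare transpose_matrix_vector [simp del]

section \<open>Energy, symmetry and locality of weighted Laplacians\<close>

lemma diag_mat_of_mult_vec: "diag_mat_of s *v w = s * w"
  by (simp add: vec_eq_iff diag_mat_of_def matrix_vector_mult_def
      if_distrib [of "\<lambda>x. x * _"] cong: if_cong)

lemma laplacian_mult_vec:
  "laplacian ends s *v w = transpose (gradient ends) *v (s * (gradient ends *v w))"
  by (simp add: laplacian_def diag_mat_of_mult_vec flip: matrix_vector_mul_assoc)

lemma inner_transpose_mult_vec:
  fixes A :: "real^'n^'m"
  shows "w \<bullet> (transpose A *v y) = (A *v w) \<bullet> y"
  by (metis dot_lmul_matrix inner_commute transpose_matrix_vector)

lemma inner_laplacian:
  "w \<bullet> (laplacian ends s *v w) = (\<Sum>k\<in>UNIV. s $ k * ((gradient ends *v w) $ k)\<^sup>2)"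
proof -
  have "w \<bullet> (laplacian ends s *v w) = (gradient ends *v w) \<bullet> (s * (gradient ends *v w))"
    by (simp add: laplacian_mult_vec inner_transpose_mult_vec)
  then show ?thesis
    by (simp add: inner_vec_def power2_eq_square mult_ac)
qed

lemma transpose_laplacian: "transpose (laplacian ends s) = laplacian ends s"
proof -
  have "transpose (diag_mat_of s) = diag_mat_of s"
    by (auto simp: vec_eq_iff transpose_def diag_mat_of_def)
  then show ?thesis
    by (simp add: laplacian_def matrix_transpose_mul matrix_mul_assoc)
qed

lemma laplacian_add: "laplacian ends (s + t) *v w = laplacian ends s *v w + laplacian ends t *v w"
  by (simp add: laplacian_mult_vec distrib_right matrix_vector_right_distrib)

text \<open>Row i collects only the fluxes through edges at i, and these edges all carry weight
  zero.\<close>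

lemma laplacian_mult_vec_nth_eq_0:
  assumes "\<forall>k\<in>edges_touching ends X. s $ k = 0" "i \<in> X"
  shows "(laplacian ends s *v w) $ i = 0"
proof -
  have "gradient ends $ k $ i * (s $ k * (gradient ends *v w) $ k) = 0" for k
    using assms by (cases "s $ k = 0") (auto simp: gradient_def edges_touching_def)
  then have "(\<Sum>k\<in>UNIV. gradient ends $ k $ i * (s $ k * (gradient ends *v w) $ k)) = 0"
    by (intro sum.neutral) blast
  then show ?thesis
    unfolding laplacian_mult_vec by (simp add: matrix_vector_mult_def transpose_def)
qed

text \<open>Dual locality: an edge of nonzero weight has both endpoints outside \<open>X\<close>, so
  no flux depends on the values on \<open>X\<close>.\<close>

lemma laplacian_mult_vec_cong:
  assumes "\<forall>k\<in>edges_touching ends X. s $ k = 0" "\<And>i. i \<notin> X \<Longrightarrow> w $ i = w' $ i"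
  shows "laplacian ends s *v w = laplacian ends s *v w'"
proof -
  have "s $ k * (gradient ends *v w) $ k = s $ k * (gradient ends *v w') $ k" for k
  proof (cases "s $ k = 0")
    case False
    then have "fst (ends k) \<notin> X" "snd (ends k) \<notin> X"
      using assms(1) by (auto simp: edges_touching_def)
    then show ?thesis
      using assms(2) by (simp add: gradient_mult_vec)
  qed simp
  then have "s * (gradient ends *v w) = s * (gradient ends *v w')"
    by (simp add: vec_eq_iff)
  then show ?thesis
    by (simp add: laplacian_mult_vec)
qed

lemma gradient_eq_0_imp_const:
  assumes "connected_graph ends" "gradient ends *v w = 0"
  shows "w $ i = w $ j"
proof -
  have step: "w $ x = w $ y" if adj: "adjacent ends x y" for x y
  proof -
    obtain k where "ends k = (x, y) \<or> ends k = (y, x)"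
      using adj by (auto simp: adjacent_def)
    moreover have "(gradient ends *v w) $ k = 0"
      using assms by simp
    ultimately show ?thesis
      by (auto simp: gradient_mult_vec)
  qed
  have "(adjacent ends)\<^sup>*\<^sup>* i j"
    using assms by (simp add: connected_graph_def)
  then show ?thesis
    by induction (auto dest: step)
qed

section \<open>Extension by zero and the Dirichlet problem\<close>

lemma sub_matrix_conv_restr: "sub_matrix A ix iy = restr ix ** A ** transpose (restr iy)"
  by (simp add: vec_eq_iff sub_matrix_def restr_def matrix_matrix_mult_def transpose_def
      if_distrib [of "\<lambda>x. x * _"] if_distrib [of "\<lambda>x. _ * x"] cong: if_cong)

lemma transpose_restr_mult_vec_in:
  assumes "inj ix"
  shows "(transpose (restr ix) *v x) $ ix a = x $ a"
  using assms
  by (simp add: restr_def matrix_vector_mult_def transpose_def inj_eq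
      if_distrib [of "\<lambda>x. x * _"] cong: if_cong)

lemma transpose_restr_mult_vec_notin:
  assumes "i \<notin> range ix"
  shows "(transpose (restr ix) *v x) $ i = 0"
proof -
  have "i \<noteq> ix a" for a
    using assms by auto
  then show ?thesis
    by (simp add: restr_def matrix_vector_mult_def transpose_def)
qed

lemma transpose_restr_restr:
  assumes "inj ix"
  shows "transpose (restr ix) *v (restr ix *v w) = w * ind_vec (range ix)"
proof -
  have "(transpose (restr ix) *v (restr ix *v w)) $ i = w $ i * indicator (range ix) i" for i
    using assms
    by (cases "i \<in> range ix")
       (auto simp: transpose_restr_mult_vec_in transpose_restr_mult_vec_notin restr_mult_vec)
  then show ?thesis
    by (simp add: vec_eq_iff ind_vec_def)
qed

text \<open>Extended by zero, a kernel vector has zero energy. Positive weights make its gradient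
  vanish, so by connectedness it is constant, and it is 0 at a node outside \<open>range ix\<close>.
  A square matrix with trivial kernel is invertible.\<close>

lemma invertible_dirichlet_laplacian:
  assumes "connected_graph ends" "\<forall>k. 0 < \<sigma> $ k" "inj ix" "range ix \<noteq> UNIV"
  shows "invertible (sub_matrix (laplacian ends \<sigma>) ix ix)"
proof -
  let ?A = "sub_matrix (laplacian ends \<sigma>) ix ix"
  have "x = 0" if "?A *v x = 0" for x
  proof -
    define w where "w = transpose (restr ix) *v x"
    have "w \<bullet> (laplacian ends \<sigma> *v w) = x \<bullet> (?A *v x)"
      using inner_transpose_mult_vec [of "laplacian ends \<sigma> *v w" "restr ix" x]
      by (simp add: w_def sub_matrix_conv_restr inner_commute flip: matrix_vector_mul_assoc)
    then have "(\<Sum>k\<in>UNIV. \<sigma> $ k * ((gradient ends *v w) $ k)\<^sup>2) = 0"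
      using that by (simp add: inner_laplacian)
    then have "\<forall>k. \<sigma> $ k * ((gradient ends *v w) $ k)\<^sup>2 = 0"
      using assms(2) by (subst (asm) sum_nonneg_eq_0_iff) (auto simp: less_imp_le)
    then have "gradient ends *v w = 0"
      using assms(2) by (simp add: vec_eq_iff) (metis less_irrefl)
    then have const: "w $ i = w $ j" for i j
      using assms(1) gradient_eq_0_imp_const by blast
    obtain b where "b \<notin> range ix"
      using assms(4) by blast
    then have "w $ b = 0"
      by (simp add: w_def transpose_restr_mult_vec_notin)
    then have "w $ ix a = 0" for a
      using const by metis
    then show "x = 0"
      using assms(3) by (simp add: w_def transpose_restr_mult_vec_in vec_eq_iff)
  qed
  then show ?thesis
    by (simp add: invertible_left_inverse matrix_left_invertible_ker)
qed

lemma matrix_inv_mult_left: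
  assumes "invertible A"
  shows "matrix_inv A ** A = mat 1"
  using assms unfolding invertible_def matrix_inv_def by (rule someI2_ex) simp

text \<open>Since \<open>v\<close> is the zero extension of its restriction, the restricted
  \<open>f\<close> is the Dirichlet submatrix applied to the restricted \<open>v\<close>. Values of
  \<open>f\<close> outside \<open>range iC\<close> are discarded by \<open>green\<close>.\<close>

lemma green_mult_vec_eqI:
  assumes "connected_graph ends" "\<forall>k. 0 < \<sigma> $ k" "inj iC" "range iC \<noteq> UNIV"
    and v: "\<And>i. i \<notin> range iC \<Longrightarrow> v $ i = 0"
    and f: "\<And>i. i \<in> range iC \<Longrightarrow> (laplacian ends \<sigma> *v v) $ i = f $ i"
  shows "green ends \<sigma> iC *v f = v"
proof -
  let ?A = "sub_matrix (laplacian ends \<sigma>) iC iC"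
  have extend: "transpose (restr iC) *v (restr iC *v v) = v"
    using v \<open>inj iC\<close>
    by (auto simp: transpose_restr_restr vec_eq_iff ind_vec_def indicator_def)
  have "restr iC *v f = restr iC *v (laplacian ends \<sigma> *v v)"
    using f by (simp add: vec_eq_iff restr_mult_vec)
  also have "\<dots> = ?A *v (restr iC *v v)"
    by (simp add: sub_matrix_conv_restr extend flip: matrix_vector_mul_assoc)
  finally have "matrix_inv ?A *v (restr iC *v f) = (matrix_inv ?A ** ?A) *v (restr iC *v v)"
    by (simp flip: matrix_vector_mul_assoc)
  also have "\<dots> = restr iC *v v"
    using invertible_dirichlet_laplacian [OF assms(1-4)] by (simp add: matrix_inv_mult_left)
  finally show ?thesis
    by (simp add: green_def extend flip: matrix_vector_mul_assoc)
qed

section \<open>Layer potentials as the Green function of a commutator\<close>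

lemma matrix_mult_vec_uminus:
  fixes A :: "real^'n^'m"
  shows "A *v (- x) = - (A *v x)" and "(- A) *v x = - (A *v x)"
  by (simp_all add: vec_eq_iff matrix_vector_mult_def sum_negf)

lemma transpose_uminus: "transpose (- A) = - transpose (A :: real^'n^'m)"
  by (simp add: vec_eq_iff transpose_def)

text \<open>Symmetry moves the Laplacian to the left in the transpose of \<open>gamma1_plus\<close>,
  and extending a trace by zero after restriction is multiplication by
  \<open>ind_vec (range iD)\<close>. The minus sign in \<open>gamma1_plus\<close> fixes the order of
  the difference; it is reversed in the next lemma.\<close>

lemma layers_plus_eq_green:
  assumes "inj iD"
  shows "single_layer ends \<sigma> iC iD *v (gamma1_plus ends \<sigma> pp iD *v u)
      - double_layer_plus ends \<sigma> pp iC iD *v (gamma0 iD *v u)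
    = green ends \<sigma> iC *v (laplacian ends (pp * \<sigma>) *v (u * ind_vec (range iD))
        - (laplacian ends (pp * \<sigma>) *v u) * ind_vec (range iD))"
  by (simp add: single_layer_def double_layer_plus_def gamma1_plus_def gamma0_def
      matrix_mult_vec_uminus transpose_uminus
      matrix_transpose_mul transpose_laplacian transpose_restr_restr [OF assms]
      matrix_vector_mult_diff_distrib flip: matrix_vector_mul_assoc)

lemma layers_minus_eq_green:
  assumes "inj iD"
  shows "single_layer ends \<sigma> iC iD *v (gamma1_minus ends \<sigma> pm iD *v u)
      - double_layer_minus ends \<sigma> pm iC iD *v (gamma0 iD *v u)
    = green ends \<sigma> iC *v ((laplacian ends (pm * \<sigma>) *v u) * ind_vec (range iD)
        - laplacian ends (pm * \<sigma>) *v (u * ind_vec (range iD)))"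
  by (simp add: single_layer_def double_layer_minus_def gamma1_minus_def gamma0_def
      matrix_transpose_mul transpose_laplacian transpose_restr_restr [OF assms]
      matrix_vector_mult_diff_distrib flip: matrix_vector_mul_assoc)

theorem theorem3p1:
  fixes ends :: "'e::finite \<Rightarrow> 'v::finite \<times> 'v"
    and B Op dO Om :: "'v set"
    and iC :: "'c::finite \<Rightarrow> 'v"
    and iD :: "'d::finite \<Rightarrow> 'v"
    and \<sigma> pp pm :: "real^'e"
    and u :: "real^'v"
  assumes graph: "simple_graph ends" "connected_graph ends"
    and partition: "partition_on UNIV {B, Op, dO, Om}" "distinct [B, Op, dO, Om]"
    and joined: "joined ends B Op" "joined ends Op dO" "joined ends dO Om"
    and not_joined: "\<not> joined ends B dO" "\<not> joined ends B Om" "\<not> joined ends Op Om"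
    and iC: "bij_betw iC UNIV (UNIV - B)"
    and iD: "bij_betw iD UNIV dO"
    and conductivity: "\<forall>k. 0 < \<sigma> $ k"
    and pp_range: "\<forall>k. pp $ k \<in> {0..1}"
    and pm_range: "\<forall>k. pm $ k \<in> {0..1}"
    and pp_pm_sum: "pp + pm = 1"
    and pp_one: "\<forall>k \<in> edges_touching ends (B \<union> Op). pp $ k = 1"
    and pm_one: "\<forall>k \<in> edges_touching ends Om. pm $ k = 1"
  shows
    "((\<forall>i \<in> Om \<union> dO. (laplacian ends \<sigma> *v u) $ i = 0) \<longrightarrow>
        single_layer ends \<sigma> iC iD *v (gamma1_plus ends \<sigma> pp iD *v u)
        - double_layer_plus ends \<sigma> pp iC iD *v (gamma0 iD *v u)
        = u * ind_vec (dO \<union> Om)) \<and>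
     ((\<forall>i \<in> Om. (laplacian ends \<sigma> *v u) $ i = 0) \<longrightarrow>
        single_layer ends \<sigma> iC iD *v (gamma1_minus ends \<sigma> pm iD *v u)
        - double_layer_minus ends \<sigma> pm iC iD *v (gamma0 iD *v u)
        = u * ind_vec Om) \<and>
     ((\<forall>i \<in> Op. (laplacian ends \<sigma> *v u) $ i = 0) \<and> (\<forall>i \<in> B. u $ i = 0) \<longrightarrow>
        - (single_layer ends \<sigma> iC iD *v (gamma1_plus ends \<sigma> pp iD *v u))
        + double_layer_plus ends \<sigma> pp iC iD *v (gamma0 iD *v u)
        = u * ind_vec (B \<union> Op)) \<and>
     ((\<forall>i \<in> Op \<union> dO. (laplacian ends \<sigma> *v u) $ i = 0) \<and> (\<forall>i \<in> B. u $ i = 0) \<longrightarrow>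
        - (single_layer ends \<sigma> iC iD *v (gamma1_minus ends \<sigma> pm iD *v u))
        + double_layer_minus ends \<sigma> pm iC iD *v (gamma0 iD *v u)
        = u * ind_vec (B \<union> Op \<union> dO))"
proof -
  have injC: "inj iC" and ranC: "range iC = - B" and injD: "inj iD" and ranD: "range iD = dO"
    using iC iD by (auto simp: bij_betw_def)
  have cover: "B \<union> Op \<union> dO \<union> Om = UNIV" and "B \<noteq> {}"
    using partition(1) by (auto simp: partition_on_def)
  \<comment> \<open>\<open>partition_on\<close> sees only the set of blocks, where equal blocks
    would merge; \<open>distinct\<close> excludes this.\<close>
  have disj: "B \<inter> Op = {}" "B \<inter> dO = {}" "B \<inter> Om = {}" "Op \<inter> dO = {}" "Op \<inter> Om = {}" "dO \<inter> Om = {}"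
    using partition by (auto simp: partition_on_def disjoint_def)
  define Lp where "Lp w = laplacian ends (pp * \<sigma>) *v w" for w
  define Lm where "Lm w = laplacian ends (pm * \<sigma>) *v w" for w
  have sum_nth: "pp $ k + pm $ k = 1" for k
    using pp_pm_sum by (simp add: vec_eq_iff)
  have pm_eq_0: "\<forall>k\<in>edges_touching ends (B \<union> Op). (pm * \<sigma>) $ k = 0"
    using pp_one sum_nth by (auto simp: add_cancel_left_right) (metis add_cancel_left_right)
  have pp_eq_0: "\<forall>k\<in>edges_touching ends Om. (pp * \<sigma>) $ k = 0"
    using pm_one sum_nth by (auto simp: add_cancel_right_left) (metis add_cancel_right_left)
  have L_split: "laplacian ends \<sigma> *v w = Lp w + Lm w" for w
  proof -
    have "\<sigma> = pp * \<sigma> + pm * \<sigma>"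
      using pp_pm_sum by (simp flip: distrib_right)
    then show ?thesis
      by (metis Lp_def Lm_def laplacian_add)
  qed
  have Lp_0: "Lp w $ i = 0" if "i \<in> Om" for w i
    using laplacian_mult_vec_nth_eq_0 [OF pp_eq_0 that] by (simp add: Lp_def)
  have Lm_0: "Lm w $ i = 0" if "i \<in> B \<union> Op" for w i
    using laplacian_mult_vec_nth_eq_0 [OF pm_eq_0 that] by (simp add: Lm_def)
  have Lp_cong: "Lp w = Lp w'" if "\<And>i. i \<notin> Om \<Longrightarrow> w $ i = w' $ i" for w w'
    using laplacian_mult_vec_cong [OF pp_eq_0 that] by (simp add: Lp_def)
  have Lm_cong: "Lm w = Lm w'" if "\<And>i. i \<notin> B \<union> Op \<Longrightarrow> w $ i = w' $ i" for w w'
    using laplacian_mult_vec_cong [OF pm_eq_0 that] by (simp add: Lm_def)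
  have Lpm_linear: "Lp (w - w') = Lp w - Lp w'" "Lm (w - w') = Lm w - Lm w'"
    "Lp (- w) = - Lp w" "Lm (- w) = - Lm w" "Lp 0 = 0" "Lm 0 = 0" for w w'
    by (simp_all add: Lp_def Lm_def matrix_vector_mult_diff_distrib matrix_mult_vec_uminus)
  have greenI: "green ends \<sigma> iC *v f = v"
    if "\<And>i. i \<in> B \<Longrightarrow> v $ i = 0" "\<And>i. i \<notin> B \<Longrightarrow> (Lp v + Lm v) $ i = f $ i" for f v
    using green_mult_vec_eqI [OF graph(2) conductivity injC, of v f] that \<open>B \<noteq> {}\<close>
    by (auto simp: ranC L_split)
  let ?P = "\<lambda>w. w * ind_vec dO"
  note plus = layers_plus_eq_green [OF injD, of ends \<sigma> iC pp u, unfolded ranD, folded Lp_def]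
  note minus = layers_minus_eq_green [OF injD, of ends \<sigma> iC pm u, unfolded ranD, folded Lm_def]
  note ind = ind_vec_def indicator_def
  have region: "i \<in> B \<or> i \<in> Op \<or> i \<in> dO \<or> i \<in> Om" for i
    using cover by blast
  have 1: "green ends \<sigma> iC *v (Lp (?P u) - ?P (Lp u)) = u * ind_vec (dO \<union> Om)" (is "_ = ?v")
    if "\<forall>i\<in>Om \<union> dO. (laplacian ends \<sigma> *v u) $ i = 0"
  proof (rule greenI)
    show "?v $ i = 0" if "i \<in> B" for i
      using that disj by (auto simp: ind)
    \<comment> \<open>\<open>Lp\<close> ignores values on \<open>Om\<close>, and \<open>Lm\<close>
      those on \<open>B \<union> Op\<close>. Each may therefore replace the truncation by any vector
      that agrees with it elsewhere; the same device serves all four cases.\<close>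
    have "Lp ?v = Lp (?P u)"
      by (rule Lp_cong) (auto simp: ind)
    moreover have "Lm ?v = Lm u"
      using region by (intro Lm_cong) (auto simp: ind)
    moreover have "Lm u $ i = - Lp u $ i" if "i \<in> Om \<union> dO" for i
      using that \<open>\<forall>i\<in>Om \<union> dO. _ i = 0\<close>
      by (simp add: L_split eq_neg_iff_add_eq_0 add.commute)
    ultimately show "(Lp ?v + Lm ?v) $ i = (Lp (?P u) - ?P (Lp u)) $ i" for i
      using region [of i] disj Lp_0 [of i u] Lm_0 [of i u]
      by (auto simp: ind)
  qed
  have 2: "green ends \<sigma> iC *v (?P (Lm u) - Lm (?P u)) = u * ind_vec Om" (is "_ = ?v")
    if "\<forall>i\<in>Om. (laplacian ends \<sigma> *v u) $ i = 0"
  proof (rule greenI)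
    show "?v $ i = 0" if "i \<in> B" for i
      using that disj by (auto simp: ind)
    have "Lp ?v = Lp 0"
      by (rule Lp_cong) (auto simp: ind)
    \<comment> \<open>Subtracting \<open>?P u\<close> removes the interface values, which
      \<open>Lm\<close> does see and which this truncation omits.\<close>
    moreover have "Lm ?v = Lm (u - ?P u)"
      using region disj by (intro Lm_cong) (auto simp: ind)
    moreover have "Lm u $ i = - Lp u $ i" if "i \<in> Om" for i
      using that \<open>\<forall>i\<in>Om. _ i = 0\<close>
      by (simp add: L_split eq_neg_iff_add_eq_0 add.commute)
    ultimately show "(Lp ?v + Lm ?v) $ i = (?P (Lm u) - Lm (?P u)) $ i" for i
      using region [of i] disj Lp_0 [of i u] Lm_0 [of i u]
      by (auto simp: ind Lpm_linear)
  qed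
  have 3: "green ends \<sigma> iC *v (Lp (?P u) - ?P (Lp u)) = - (u * ind_vec (B \<union> Op))" (is "_ = - ?v")
    if "\<forall>i\<in>Op. (laplacian ends \<sigma> *v u) $ i = 0" "\<forall>i\<in>B. u $ i = 0"
  proof (rule greenI)
    \<comment> \<open>Here the truncation keeps the values on \<open>B\<close>, so the Dirichlet
      condition has to come from \<open>u\<close> itself.\<close>
    show "(- ?v) $ i = 0" if "i \<in> B" for i
      using that \<open>\<forall>i\<in>B. u $ i = 0\<close> by simp
    have "Lp (- ?v) = Lp (?P u - u)"
      using region disj by (intro Lp_cong) (auto simp: ind)
    moreover have "Lm (- ?v) = Lm 0"
      by (rule Lm_cong) (auto simp: ind)
    moreover have "Lp u $ i = - Lm u $ i" if "i \<in> Op" for i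
      using that \<open>\<forall>i\<in>Op. _ i = 0\<close>
      by (simp add: L_split eq_neg_iff_add_eq_0 add.commute)
    \<comment> \<open>On \<open>B\<close> the two sides differ by \<open>Lp u\<close>, about which
      no equation is assumed, so the comparison is made only off \<open>B\<close>.\<close>
    ultimately show "(Lp (- ?v) + Lm (- ?v)) $ i = (Lp (?P u) - ?P (Lp u)) $ i" if "i \<notin> B" for i
      using region [of i] that disj Lp_0 [of i u] Lm_0 [of i u]
      by (auto simp: ind Lpm_linear)
  qed
  have 4: "green ends \<sigma> iC *v (?P (Lm u) - Lm (?P u)) = - (u * ind_vec (B \<union> Op \<union> dO))"
    (is "_ = - ?v")
    if "\<forall>i\<in>Op \<union> dO. (laplacian ends \<sigma> *v u) $ i = 0" "\<forall>i\<in>B. u $ i = 0"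
  proof (rule greenI)
    show "(- ?v) $ i = 0" if "i \<in> B" for i
      using that \<open>\<forall>i\<in>B. u $ i = 0\<close> by simp
    have "Lp (- ?v) = Lp (- u)"
      using region by (intro Lp_cong) (auto simp: ind)
    moreover have "Lm (- ?v) = Lm (- ?P u)"
      by (rule Lm_cong) (auto simp: ind)
    moreover have "Lp u $ i = - Lm u $ i" if "i \<in> Op \<union> dO" for i
      using that \<open>\<forall>i\<in>Op \<union> dO. _ i = 0\<close>
      by (simp add: L_split eq_neg_iff_add_eq_0 add.commute)
    ultimately show "(Lp (- ?v) + Lm (- ?v)) $ i = (?P (Lm u) - Lm (?P u)) $ i" if "i \<notin> B" for i
      using region [of i] that disj Lp_0 [of i u] Lm_0 [of i u]
      by (auto simp: ind Lpm_linear)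
  qed
  \<comment> \<open>The left sides of the last two formulas are the negatives of those of the first
    two, so \<open>plus\<close> and \<open>minus\<close> rewrite all four.\<close>
  have neg: "- a + b = c \<longleftrightarrow> a - b = - c" for a b c :: "real^'v"
    by (metis minus_diff_eq minus_minus uminus_add_conv_diff)
  show ?thesis
    unfolding neg plus minus using 1 2 3 4 by blast
qed

end
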